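(* The completion of an orderly topological group $(G,\tau)$ is orderly.
   Context: The completion of a topological group is its Raikov completion, i.e. the completion with respect to its two-sided uniform structure, which is naturally a topological group. The interval topology of a linearly ordered set has as subbase all rays $\{x: a<x\}$, $\{x: x<b\}$. A compact linearly ordered space is a linearly ordered set whose interval topology is compact, equipped with that topology. $H_+(K)$ is the group of all order-preserving homeomorphisms $K\to K$ with the compact-open topology. A topological group is orderly if it embeds as a topological group (injective homomorphism, homeomorphism onto its image) into $H_+(K)$ for some compact linearly ordered space $K$. *)

theory Defs
  imports "HOL-Analysis.Analysis" "HOL-Algebra.Bij"
begin

section \<open>Topological groups and the Raikov completion\<close>

definition topological_group :: "('a, 'm) monoid_scheme \<Rightarrow> 'a topology \<Rightarrow> bool" where
  "topological_group G T \<longleftrightarrow>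
     group G \<and> topspace T = carrier G \<and>
     continuous_map (prod_topology T T) T (\<lambda>(x, y). x \<otimes>\<^bsub>G\<^esub> y) \<and>
     continuous_map T T (\<lambda>x. inv\<^bsub>G\<^esub> x)"

text \<open>A uniformity on a set \<open>X\<close> is represented by its filter of entourages, a filter on
  \<open>'a \<times> 'a\<close> below \<open>principal (X \<times> X)\<close>. The two-sided uniformity is the join of the left and the
  right uniformity.\<close>

definition two_sided_uniformity :: "('a, 'm) monoid_scheme \<Rightarrow> 'a topology \<Rightarrow> ('a \<times> 'a) filter" where
  "two_sided_uniformity G T =
     (INF U \<in> {U. openin T U \<and> \<one>\<^bsub>G\<^esub> \<in> U}.
        principal {(x, y). x \<in> carrier G \<and> y \<in> carrier G \<and>
                           inv\<^bsub>G\<^esub> x \<otimes>\<^bsub>G\<^esub> y \<in> U \<and> x \<otimes>\<^bsub>G\<^esub> inv\<^bsub>G\<^esub> y \<in> U})"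

definition raikov_complete :: "('a, 'm) monoid_scheme \<Rightarrow> 'a topology \<Rightarrow> bool" where
  "raikov_complete G T \<longleftrightarrow>
     (\<forall>F. F \<noteq> bot \<and> F \<le> principal (carrier G) \<and> F \<times>\<^sub>F F \<le> two_sided_uniformity G T \<longrightarrow>
        (\<exists>x \<in> carrier G. F \<le> nhdsin T x))"

text \<open>The completion is determined up to a unique isomorphism over \<open>G\<close>, so it is described by a
  predicate: \<open>\<iota>\<close> exhibits \<open>(G', T')\<close> as the Hausdorff completion of \<open>G\<close> with respect to
  the two-sided uniformity. The equation between filters says that the uniformity of \<open>G\<close> is the
  one pulled back along \<open>\<iota>\<close>.\<close>

definition is_raikov_completion ::
  "('a, 'm) monoid_scheme \<Rightarrow> 'a topology \<Rightarrow> ('b, 'n) monoid_scheme \<Rightarrow> 'b topology \<Rightarrow> ('a \<Rightarrow> 'b) \<Rightarrow> bool"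
where
  "is_raikov_completion G T G' T' \<iota> \<longleftrightarrow>
     topological_group G' T' \<and> Hausdorff_space T' \<and> raikov_complete G' T' \<and>
     \<iota> \<in> mon G G' \<and>
     two_sided_uniformity G T =
       inf (filtercomap (map_prod \<iota> \<iota>) (two_sided_uniformity G' T'))
           (principal (carrier G \<times> carrier G)) \<and>
     T' closure_of (\<iota> ` carrier G) = carrier G'"


section \<open>Compact linearly ordered spaces and orderly groups\<close>

text \<open>The set \<open>K\<close> itself is added to the subbase because \<open>topology_generated_by\<close> does not include
  the empty intersection; this matters only if \<open>K\<close> is a singleton.\<close>

definition interval_topology :: "'k set \<Rightarrow> 'k rel \<Rightarrow> 'k topology" where
  "interval_topology K r = topology_generated_by
     (insert K ({{x \<in> K. (a, x) \<in> r \<and> a \<noteq> x} | a. a \<in> K} \<union>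
                {{x \<in> K. (x, b) \<in> r \<and> x \<noteq> b} | b. b \<in> K}))"

definition compact_linearly_ordered_space :: "'k set \<Rightarrow> 'k rel \<Rightarrow> bool" where
  "compact_linearly_ordered_space K r \<longleftrightarrow>
     linear_order_on K r \<and> compact_space (interval_topology K r)"

text \<open>Maps \<open>K \<rightarrow> K\<close> are represented by functions that are \<open>extensional\<close> on \<open>K\<close>, as in
  \<open>BijGroup K\<close>, of which \<open>H_plus K r\<close> is a subgroup.\<close>

definition H_plus :: "'k set \<Rightarrow> 'k rel \<Rightarrow> ('k \<Rightarrow> 'k) monoid" where
  "H_plus K r = (BijGroup K)
     \<lparr>carrier := {f \<in> extensional K.
        homeomorphic_map (interval_topology K r) (interval_topology K r) f \<and>
        (\<forall>x\<in>K. \<forall>y\<in>K. (x, y) \<in> r \<longrightarrow> (f x, f y) \<in> r)}\<rparr>"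

definition compact_open_topology :: "'a topology \<Rightarrow> 'b topology \<Rightarrow> ('a \<Rightarrow> 'b) set \<Rightarrow> ('a \<Rightarrow> 'b) topology"
where
  "compact_open_topology X Y \<F> =
     topology_generated_by {{f \<in> \<F>. f ` C \<subseteq> U} | C U. compactin X C \<and> openin Y U}"

definition H_plus_topology :: "'k set \<Rightarrow> 'k rel \<Rightarrow> ('k \<Rightarrow> 'k) topology" where
  "H_plus_topology K r =
     compact_open_topology (interval_topology K r) (interval_topology K r) (carrier (H_plus K r))"

text \<open>HOL cannot quantify existentially over types, so the type \<open>'k\<close> in which \<open>K\<close> is sought is a
  parameter; \<open>K\<close> ranges over all subsets of \<open>'k\<close> and all linear orders on them.\<close>

definition orderly :: "'k itself \<Rightarrow> ('a, 'm) monoid_scheme \<Rightarrow> 'a topology \<Rightarrow> bool" where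
  "orderly (_ :: 'k itself) G T \<longleftrightarrow>
     topological_group G T \<and>
     (\<exists>(K :: 'k set) r \<phi>. compact_linearly_ordered_space K r \<and>
        \<phi> \<in> mon G (H_plus K r) \<and> embedding_map T (H_plus_topology K r) \<phi>)"

end

theory Submission
  imports Defs
begin

text \<open>The same space \<open>K\<close> serves for the completion, since \<open>H_plus K r\<close> is itself complete. Given a
  family in \<open>H_plus K r\<close> that is Cauchy for the two-sided uniformity, both the family and the family
  of inverses converge pointwise by compactness. The two limits are monotone and mutually inverse,
  hence homeomorphisms for the interval topology, and the Cauchy property upgrades pointwise to
  compact-open convergence. A point \<open>y\<close> of the completion is therefore sent to the limit of \<open>\<phi>\<close>
  along the trace on \<open>G\<close> of the neighbourhoods of \<open>y\<close>.\<close>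


section \<open>Cauchy families of homeomorphisms of a compact Hausdorff space\<close>

text \<open>Two-sidedness is what keeps the limit a bijection. Increasing homeomorphisms of an
  interval can converge uniformly to a map that collapses a subinterval. Along such a sequence
  \<open>a i (b j x)\<close> still tends to \<open>x\<close>; it is the condition on the reversed
  quotients \<open>b i (a j x)\<close> that excludes this. The recurring obstacle is that limits
  preserve closed conditions, whereas the compact-open topology prescribes open targets. A target
  \<open>U\<close> is therefore shrunk beforehand to an open \<open>W\<close> whose closure still
  lies in \<open>U\<close>; values in \<open>W\<close> then have their limit in that closure.
  Uniqueness of limits is always taken in the compact Hausdorff space \<open>K\<close>, one point at
  a time. An embedding into \<open>H_plus K r\<close> also requires openness of the extension. It is
  proved at the unit, by writing a point of the completion as an element of \<open>G\<close> times a
  small error, and then translated.\<close>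

text \<open>Here \<open>b i\<close> plays the role of the inverse of \<open>a i\<close>, so that the two conditions for \<open>a, b\<close> and
  \<open>b, a\<close> together say that \<open>a\<close> is Cauchy for the two-sided uniformity.\<close>

definition quotients_tend_to_id ::
  "'x topology \<Rightarrow> 'i filter \<Rightarrow> ('i \<Rightarrow> 'x \<Rightarrow> 'x) \<Rightarrow> ('i \<Rightarrow> 'x \<Rightarrow> 'x) \<Rightarrow> bool" where
  "quotients_tend_to_id X F a b \<longleftrightarrow>
     (\<forall>C U. compactin X C \<and> openin X U \<and> C \<subseteq> U \<longrightarrow>
        (\<forall>\<^sub>F (i, j) in F \<times>\<^sub>F F. \<forall>x\<in>C. a i (b j x) \<in> U))"

lemma quotients_tend_to_idD:
  assumes "quotients_tend_to_id X F a b" "compactin X C" "openin X U" "C \<subseteq> U"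
  shows "\<exists>P. eventually P F \<and> (\<forall>i j x. P i \<longrightarrow> P j \<longrightarrow> x \<in> C \<longrightarrow> a i (b j x) \<in> U)"
proof -
  have "\<forall>\<^sub>F (i, j) in F \<times>\<^sub>F F. \<forall>x\<in>C. a i (b j x) \<in> U"
    using assms unfolding quotients_tend_to_id_def by blast
  then show ?thesis
    unfolding eventually_prod_same by auto
qed

text \<open>If every point had a neighbourhood that \<open>f\<close> eventually avoids, finitely
  many of these would cover the space, and eventually \<open>f i\<close> would have nowhere to
  lie.\<close>

lemma compact_space_cluster_point:
  assumes "compact_space X" "F \<noteq> bot" "\<forall>\<^sub>F i in F. f i \<in> topspace X"
  obtains y where "y \<in> topspace X" "\<And>U. openin X U \<Longrightarrow> y \<in> U \<Longrightarrow> \<exists>\<^sub>F i in F. f i \<in> U"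
proof (rule ccontr)
  assume "\<not> thesis"
  then have *: "\<forall>y\<in>topspace X. \<exists>U. openin X U \<and> y \<in> U \<and> (\<forall>\<^sub>F i in F. f i \<notin> U)"
    using that unfolding frequently_def by blast
  define \<U> where "\<U> = {U. openin X U \<and> (\<forall>\<^sub>F i in F. f i \<notin> U)}"
  have "topspace X \<subseteq> \<Union>\<U>" "\<forall>U\<in>\<U>. openin X U"
    using * by (auto simp: \<U>_def)
  then obtain \<V> where \<V>: "finite \<V>" "\<V> \<subseteq> \<U>" "topspace X \<subseteq> \<Union>\<V>"
    using assms(1) unfolding compact_space_alt by meson
  then have "\<forall>\<^sub>F i in F. \<forall>U\<in>\<V>. f i \<notin> U"
    unfolding eventually_ball_finite_distrib[OF \<V>(1)] \<U>_def by blast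
  with assms(3) have "\<forall>\<^sub>F i in F. False"
    by eventually_elim (use \<V>(3) in blast)
  with assms(2) show False by simp
qed

lemma compact_Hausdorff_shrink:
  assumes X: "compact_space X" "Hausdorff_space X"
    and D: "compactin X D" "openin X U" "D \<subseteq> U"
  shows "\<exists>W. openin X W \<and> D \<subseteq> W \<and> X closure_of W \<subseteq> U"
proof -
  have "normal_space X"
    using compact_Hausdorff_or_regular_imp_normal_space X by blast
  moreover have "closedin X D"
    using compactin_imp_closedin X(2) D(1) .
  ultimately show ?thesis
    using D(2,3) unfolding normal_space_alt by simp
qed

text \<open>A Cauchy family converges to its cluster points. Fix \<open>j\<close> with
  \<open>a j x\<close> close to the cluster point; then \<open>a i x = a i (b j (a j x))\<close>,
  and for all late \<open>i\<close> the quotient moves \<open>a j x\<close> only slightly.\<close>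

lemma quotients_tend_to_id_pointwise_limit:
  assumes X: "compact_space X" "Hausdorff_space X" and F: "F \<noteq> bot"
    and cauchy: "quotients_tend_to_id X F a b"
    and ev: "\<forall>\<^sub>F i in F. a i x \<in> topspace X \<and> b i (a i x) = x"
  obtains y where "limitin X (\<lambda>i. a i x) y F"
proof -
  have "\<forall>\<^sub>F i in F. a i x \<in> topspace X"
    using ev by eventually_elim auto
  from compact_space_cluster_point[OF X(1) F this] obtain y where
    y: "y \<in> topspace X" and freq: "\<And>U. openin X U \<Longrightarrow> y \<in> U \<Longrightarrow> \<exists>\<^sub>F i in F. a i x \<in> U"
    by auto
  have "\<forall>\<^sub>F i in F. a i x \<in> U" if U: "openin X U" "y \<in> U" for U
  proof -
    have "\<exists>V. openin X V \<and> {y} \<subseteq> V \<and> X closure_of V \<subseteq> U"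
      using U y by (intro compact_Hausdorff_shrink[OF X]) auto
    then obtain V where V: "openin X V" "y \<in> V" "X closure_of V \<subseteq> U"
      by blast
    have "compactin X (X closure_of V)"
      using X(1) by (simp add: closedin_compact_space)
    from quotients_tend_to_idD[OF cauchy this U(1) V(3)] obtain P where
      P: "eventually P F" "\<And>i j z. P i \<Longrightarrow> P j \<Longrightarrow> z \<in> X closure_of V \<Longrightarrow> a i (b j z) \<in> U"
      by blast
    have "\<forall>\<^sub>F i in F. P i \<and> b i (a i x) = x"
      using P(1) ev by eventually_elim blast
    then obtain j where j: "a j x \<in> V" "P j" "b j (a j x) = x"
      using frequently_ex[OF frequently_eventually_frequently[OF freq[OF V(1,2)]]] by blast
    have "a j x \<in> X closure_of V"
      using j(1) closure_of_subset[OF openin_subset[OF V(1)]] by blast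
    then have "a i x \<in> U" if "P i" for i
      using P(2)[OF that j(2)] j(3) by force
    with P(1) show ?thesis
      by (rule eventually_mono)
  qed
  with y that show thesis
    unfolding limitin_def by blast
qed

text \<open>Taking the limit over \<open>j\<close> only. With \<open>D\<close> a point this shows that the limits of a Cauchy family
  and of its inverses are inverse to each other; with \<open>D\<close> the image of a compact set under the limit
  it gives compact-open convergence.\<close>

lemma quotients_tend_to_id_limit:
  assumes X: "compact_space X" "Hausdorff_space X" and F: "F \<noteq> bot"
    and cauchy: "quotients_tend_to_id X F a b"
    and cont: "\<forall>\<^sub>F i in F. continuous_map X X (a i)"
    and lim: "\<And>y. y \<in> D \<Longrightarrow> limitin X (\<lambda>j. b j y) (f y) F"
    and D: "compactin X D" "openin X U" "D \<subseteq> U"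
  shows "\<forall>\<^sub>F i in F. \<forall>y\<in>D. a i (f y) \<in> U"
proof -
  obtain W where W: "openin X W" "D \<subseteq> W" "X closure_of W \<subseteq> U"
    using compact_Hausdorff_shrink[OF X D] by blast
  obtain P where P: "eventually P F" "\<And>i j y. P i \<Longrightarrow> P j \<Longrightarrow> y \<in> D \<Longrightarrow> a i (b j y) \<in> W"
    using quotients_tend_to_idD[OF cauchy D(1) W(1,2)] by blast
  from P(1) cont show ?thesis
  proof eventually_elim
    case (elim i)
    show ?case
    proof
      fix y assume y: "y \<in> D"
      have "limitin X (\<lambda>j. a i (b j y)) (a i (f y)) F"
        using continuous_map_limit[OF elim(2) lim[OF y]] by (simp add: o_def)
      moreover have "\<forall>\<^sub>F j in F. a i (b j y) \<in> X closure_of W"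
        using P(1)
      proof eventually_elim
        case (elim j)
        then show ?case
          using P(2)[OF \<open>P i\<close> _ y] closure_of_subset[OF openin_subset[OF W(1)]] by blast
      qed
      ultimately have "a i (f y) \<in> X closure_of W"
        using F by (intro limitin_closedin) auto
      then show "a i (f y) \<in> U"
        using W(3) by blast
    qed
  qed
qed

lemma limitin_topology_generated_by:
  assumes l: "l \<in> \<Union>\<S>" and sub: "\<And>U. U \<in> \<S> \<Longrightarrow> l \<in> U \<Longrightarrow> \<forall>\<^sub>F i in F. f i \<in> U"
  shows "limitin (topology_generated_by \<S>) f l F"
proof -
  have "l \<in> U \<Longrightarrow> \<forall>\<^sub>F i in F. f i \<in> U" if "generate_topology_on \<S> U" for U
    using that
  proof induction
    case (Int a b)
    then show ?case by (auto simp: eventually_conj_iff)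
  next
    case (UN K)
    then obtain k where "k \<in> K" "l \<in> k" "\<forall>\<^sub>F i in F. f i \<in> k" by blast
    then show ?case by (auto elim: eventually_mono)
  qed (use sub in auto)
  with l show ?thesis
    unfolding limitin_def by (auto simp: openin_topology_generated_by_iff)
qed


section \<open>Compact linearly ordered spaces\<close>

locale compact_lots =
  fixes K :: "'k set" and r :: "'k rel"
  assumes clos: "compact_linearly_ordered_space K r"
begin

abbreviation X where "X \<equiv> interval_topology K r"
abbreviation H where "H \<equiv> H_plus K r"
abbreviation HT where "HT \<equiv> H_plus_topology K r"

lemma
  shows refl: "x \<in> K \<Longrightarrow> (x, x) \<in> r"
    and total: "x \<in> K \<Longrightarrow> y \<in> K \<Longrightarrow> (x, y) \<in> r \<or> (y, x) \<in> r"
    and antisym: "(x, y) \<in> r \<Longrightarrow> (y, x) \<in> r \<Longrightarrow> x = y"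
    and trans: "(x, y) \<in> r \<Longrightarrow> (y, z) \<in> r \<Longrightarrow> (x, z) \<in> r"
proof -
  have lin: "refl_on K r" "Relation.trans r" "Relation.antisym r" "total_on K r"
    using clos unfolding compact_linearly_ordered_space_def order_on_defs by auto
  show "x \<in> K \<Longrightarrow> (x, x) \<in> r"
    using lin(1) by (rule refl_onD)
  then show "x \<in> K \<Longrightarrow> y \<in> K \<Longrightarrow> (x, y) \<in> r \<or> (y, x) \<in> r"
    using lin(4) unfolding total_on_def by (cases "x = y") auto
  show "(x, y) \<in> r \<Longrightarrow> (y, x) \<in> r \<Longrightarrow> x = y"
    using lin(3) by (rule antisymD)
  show "(x, y) \<in> r \<Longrightarrow> (y, z) \<in> r \<Longrightarrow> (x, z) \<in> r"
    using lin(2) by (rule transD)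
qed

lemma topspace_X [simp]: "topspace X = K"
  unfolding interval_topology_def by auto

lemma openin_ray:
  assumes "a \<in> K"
  shows "openin X {x \<in> K. (a, x) \<in> r \<and> a \<noteq> x}" "openin X {x \<in> K. (x, a) \<in> r \<and> x \<noteq> a}"
  unfolding interval_topology_def by (rule topology_generated_by_Basis, use assms in blast)+

text \<open>The neighbourhoods are separated in the order and not merely disjoint; this is what
  makes the relation \<open>r\<close> closed under limits in \<open>limit_mono\<close>.\<close>

lemma separate:
  assumes "p \<in> K" "q \<in> K" "(p, q) \<in> r" "p \<noteq> q"
  obtains P Q where "openin X P" "openin X Q" "p \<in> P" "q \<in> Q"
    "\<And>u v. u \<in> P \<Longrightarrow> v \<in> Q \<Longrightarrow> (u, v) \<in> r \<and> u \<noteq> v"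
proof (cases "\<exists>c\<in>K. (p, c) \<in> r \<and> p \<noteq> c \<and> (c, q) \<in> r \<and> c \<noteq> q")
  case True
  then obtain c where c: "c \<in> K" "(p, c) \<in> r" "p \<noteq> c" "(c, q) \<in> r" "c \<noteq> q" by blast
  show thesis
  proof (rule that[OF openin_ray(2)[OF c(1)] openin_ray(1)[OF c(1)]])
    fix u v
    assume "u \<in> {x \<in> K. (x, c) \<in> r \<and> x \<noteq> c}" "v \<in> {x \<in> K. (c, x) \<in> r \<and> c \<noteq> x}"
    then show "(u, v) \<in> r \<and> u \<noteq> v"
      using trans[of u c v] antisym[of u c] by auto
  qed (use assms c in auto)
next
  case False
  \<comment> \<open>Here \<open>q\<close> is the immediate successor of \<open>p\<close>: whatever
    is strictly below \<open>q\<close> is at most \<open>p\<close>, so the rays below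
    \<open>q\<close> and above \<open>p\<close> are already separated.\<close>
  show thesis
  proof (rule that[OF openin_ray(2)[OF assms(2)] openin_ray(1)[OF assms(1)]])
    fix u v
    assume "u \<in> {x \<in> K. (x, q) \<in> r \<and> x \<noteq> q}" "v \<in> {x \<in> K. (p, x) \<in> r \<and> p \<noteq> x}"
    then have uv: "u \<in> K" "(u, q) \<in> r" "u \<noteq> q" "(p, v) \<in> r" "p \<noteq> v"
      by auto
    then have "(u, p) \<in> r"
      using False total[OF uv(1) assms(1)] by blast
    then show "(u, v) \<in> r \<and> u \<noteq> v"
      using uv(4,5) trans antisym by blast
  qed (use assms in auto)
qed

lemma compact_X: "compact_space X"
  using clos unfolding compact_linearly_ordered_space_def by blast

lemma Hausdorff_X: "Hausdorff_space X"
  unfolding Hausdorff_space_def disjnt_iff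
proof (intro allI impI)
  fix x y assume "x \<in> topspace X \<and> y \<in> topspace X \<and> x \<noteq> y"
  then show "\<exists>U V. openin X U \<and> openin X V \<and> x \<in> U \<and> y \<in> V \<and> (\<forall>z. \<not> (z \<in> U \<and> z \<in> V))"
    unfolding topspace_X
  proof (elim conjE)
    assume xy: "x \<in> K" "y \<in> K" "x \<noteq> y"
    from total[OF xy(1,2)] show ?thesis
    proof
      assume "(x, y) \<in> r"
      then show ?thesis
        by (rule separate[OF xy(1,2) _ xy(3)]) blast
    next
      assume "(y, x) \<in> r"
      then show ?thesis
        by (rule separate[OF xy(2,1) _ xy(3)[symmetric]]) blast
    qed
  qed
qed

lemma limit_mono:
  assumes "F \<noteq> bot" "limitin X a p F" "limitin X b q F" "\<forall>\<^sub>F i in F. (a i, b i) \<in> r"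
  shows "(p, q) \<in> r"
proof (rule ccontr)
  assume not: "(p, q) \<notin> r"
  have K: "p \<in> K" "q \<in> K"
    using assms(2,3) limitin_topspace by force+
  with not have "(q, p) \<in> r" "q \<noteq> p"
    using total refl by blast+
  then obtain P Q where PQ: "openin X P" "openin X Q" "q \<in> P" "p \<in> Q"
    "\<And>u v. u \<in> P \<Longrightarrow> v \<in> Q \<Longrightarrow> (u, v) \<in> r \<and> u \<noteq> v"
    by (rule separate[OF K(2,1)]) blast
  have "\<forall>\<^sub>F i in F. a i \<in> Q" "\<forall>\<^sub>F i in F. b i \<in> P"
    using assms(2,3) PQ unfolding limitin_def by blast+
  with assms(4) have "\<forall>\<^sub>F i in F. False"
    by eventually_elim (use PQ(5) antisym in blast)
  with assms(1) show False by simp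
qed

text \<open>Mutually inverse monotone maps are adjoint on both sides, so the preimage under
  \<open>f\<close> of a ray with endpoint \<open>a\<close> is the ray of the same kind with endpoint
  \<open>g a\<close>. Checking this on the subbase suffices.\<close>

lemma monotone_inverse_imp_continuous:
  assumes f: "f \<in> K \<rightarrow> K" "g \<in> K \<rightarrow> K"
    and mono: "\<And>x y. (x, y) \<in> r \<Longrightarrow> x \<in> K \<Longrightarrow> y \<in> K \<Longrightarrow> (f x, f y) \<in> r"
      "\<And>x y. (x, y) \<in> r \<Longrightarrow> x \<in> K \<Longrightarrow> y \<in> K \<Longrightarrow> (g x, g y) \<in> r"
    and inverse: "\<And>x. x \<in> K \<Longrightarrow> f (g x) = x" "\<And>x. x \<in> K \<Longrightarrow> g (f x) = x"
  shows "continuous_map X X f"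
proof -
  have galois: "(f x, b) \<in> r \<longleftrightarrow> (x, g b) \<in> r" "(b, f x) \<in> r \<longleftrightarrow> (g b, x) \<in> r"
    "f x = b \<longleftrightarrow> x = g b" "b = f x \<longleftrightarrow> g b = x" if x: "x \<in> K" and b: "b \<in> K" for x b
  proof -
    have K: "f x \<in> K" "g b \<in> K" using f x b by auto
    show "(f x, b) \<in> r \<longleftrightarrow> (x, g b) \<in> r" "(b, f x) \<in> r \<longleftrightarrow> (g b, x) \<in> r"
      using mono(2)[of "f x" b] mono(1)[of x "g b"] mono(2)[of b "f x"] mono(1)[of "g b" x]
        inverse(1)[OF b] inverse(2)[OF x] K x b by auto
    show "f x = b \<longleftrightarrow> x = g b" "b = f x \<longleftrightarrow> g b = x"
      using inverse(1)[OF b] inverse(2)[OF x] by auto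
  qed
  have fK: "f x \<in> K" if "x \<in> K" for x
    using f that by auto
  show ?thesis
    unfolding interval_topology_def[of K r]
  proof (rule continuous_on_generated_topo, unfold interval_topology_def[of K r, symmetric], goal_cases)
    case (1 U)
    then consider "U = K" | a where "a \<in> K" "U = {x \<in> K. (a, x) \<in> r \<and> a \<noteq> x}"
      | b where "b \<in> K" "U = {x \<in> K. (x, b) \<in> r \<and> x \<noteq> b}"
      by blast
    then show ?case
    proof cases
      case 1
      then have "f -` U \<inter> topspace X = topspace X"
        using f by auto
      then show ?thesis by (metis openin_topspace)
    next
      case (2 a)
      have "f -` U \<inter> topspace X = {x \<in> K. (g a, x) \<in> r \<and> g a \<noteq> x}"
        using 2 fK galois by (safe; simp)
      moreover have "g a \<in> K" using f 2 by auto
      ultimately show ?thesis using openin_ray(1) by simp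
    next
      case (3 b)
      have "f -` U \<inter> topspace X = {x \<in> K. (x, g b) \<in> r \<and> x \<noteq> g b}"
        using 3 fK galois by (safe; simp)
      moreover have "g b \<in> K" using f 3 by auto
      ultimately show ?thesis using openin_ray(2) by simp
    qed
  qed (use f in auto)
qed

section \<open>Order-preserving homeomorphisms under composition\<close>

lemma H_plusD:
  assumes "f \<in> carrier H"
  shows "f \<in> Bij K" "f \<in> extensional K" "continuous_map X X f" "x \<in> K \<Longrightarrow> f x \<in> K"
    "(x, y) \<in> r \<Longrightarrow> x \<in> K \<Longrightarrow> y \<in> K \<Longrightarrow> (f x, f y) \<in> r" "inj_on f K"
proof -
  have f: "f \<in> extensional K" "homeomorphic_map X X f"
    "\<forall>x\<in>K. \<forall>y\<in>K. (x, y) \<in> r \<longrightarrow> (f x, f y) \<in> r"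
    using assms unfolding H_plus_def by auto
  then have bij: "f ` K = K" "inj_on f K"
    using homeomorphic_imp_surjective_map homeomorphic_imp_injective_map by fastforce+
  then show "f \<in> Bij K" "inj_on f K" "x \<in> K \<Longrightarrow> f x \<in> K"
    using f by (auto simp: Bij_def bij_betw_def)
  show "f \<in> extensional K" "continuous_map X X f"
    "(x, y) \<in> r \<Longrightarrow> x \<in> K \<Longrightarrow> y \<in> K \<Longrightarrow> (f x, f y) \<in> r"
    using f homeomorphic_imp_continuous_map by blast+
qed

lemma H_plusI:
  assumes f: "f \<in> K \<rightarrow> K" "g \<in> K \<rightarrow> K" "f \<in> extensional K"
    and mono: "\<And>x y. (x, y) \<in> r \<Longrightarrow> x \<in> K \<Longrightarrow> y \<in> K \<Longrightarrow> (f x, f y) \<in> r"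
      "\<And>x y. (x, y) \<in> r \<Longrightarrow> x \<in> K \<Longrightarrow> y \<in> K \<Longrightarrow> (g x, g y) \<in> r"
    and inverse: "\<And>x. x \<in> K \<Longrightarrow> f (g x) = x" "\<And>x. x \<in> K \<Longrightarrow> g (f x) = x"
  shows "f \<in> carrier H"
proof -
  have "continuous_map X X f"
    using assms by (intro monotone_inverse_imp_continuous[of f g]) auto
  moreover have "continuous_map X X g"
    using assms by (intro monotone_inverse_imp_continuous[of g f]) auto
  ultimately have "homeomorphic_maps X X f g"
    unfolding homeomorphic_maps_def using inverse by auto
  then have "homeomorphic_map X X f"
    unfolding homeomorphic_maps_map by (rule conjunct1)
  with f(3) mono(1) show ?thesis
    unfolding H_plus_def by auto
qed

lemma mult_H:
  assumes "f \<in> carrier H" "g \<in> carrier H"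
  shows "f \<otimes>\<^bsub>H\<^esub> g = compose K f g"
  using H_plusD(1)[OF assms(1)] H_plusD(1)[OF assms(2)]
  by (simp add: H_plus_def BijGroup_def)

lemma compose_H:
  assumes "f \<in> carrier H" "g \<in> carrier H"
  shows "compose K f g \<in> carrier H"
proof -
  have "homeomorphic_map X X (f \<circ> g)"
    using assms homeomorphic_map_compose unfolding H_plus_def by auto
  then have "homeomorphic_map X X (compose K f g)"
    by (rule homeomorphic_map_eq) (simp add: compose_eq)
  moreover have "(compose K f g x, compose K f g y) \<in> r"
    if "(x, y) \<in> r" "x \<in> K" "y \<in> K" for x y
    using that H_plusD(4,5)[OF assms(1)] H_plusD(4,5)[OF assms(2)] by (simp add: compose_eq)
  ultimately show ?thesis
    unfolding H_plus_def by (simp add: compose_extensional)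
qed

text \<open>Used to recognise the image of a unit: it is idempotent because the map is
  multiplicative, and an injective idempotent map fixes every point.\<close>

lemma idempotent_H:
  assumes f: "f \<in> carrier H" "compose K f f = f"
  shows "f = (\<lambda>x\<in>K. x)"
proof
  fix x
  show "f x = (\<lambda>x\<in>K. x) x"
  proof (cases "x \<in> K")
    case True
    then have "f (f x) = f x"
      using f(2) compose_eq by metis
    then have "f x = x"
      using inj_onD[OF H_plusD(6)[OF f(1)]] H_plusD(4)[OF f(1) True] True by blast
    with True show ?thesis by simp
  next
    case False
    then show ?thesis
      using extensional_arb[OF H_plusD(2)[OF f(1)] False] by simp
  qed
qed

section \<open>The compact-open topology on \<open>H_plus\<close>\<close>

lemma topspace_HT [simp]: "topspace HT = carrier H"
proof -
  \<comment> \<open>The empty compact set imposes no condition, so the whole carrier is itself a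
    member of the subbase.\<close>
  have "compactin X {} \<and> openin X {}" by simp
  then show ?thesis
    unfolding H_plus_topology_def compact_open_topology_def topology_generated_by_topspace by blast
qed

lemma openin_HT:
  assumes "compactin X C" "openin X U"
  shows "openin HT {f \<in> carrier H. f ` C \<subseteq> U}"
  unfolding H_plus_topology_def compact_open_topology_def
  by (rule topology_generated_by_Basis, use assms in blast)

lemma limitin_HT_pointwise:
  assumes "limitin HT \<phi> f F" "x \<in> K"
  shows "limitin X (\<lambda>i. \<phi> i x) (f x) F"
proof -
  have f: "f \<in> carrier H"
    using assms(1) limitin_topspace by force
  have "\<forall>\<^sub>F i in F. \<phi> i x \<in> U" if "openin X U" "f x \<in> U" for U
  proof -
    have "openin HT {f \<in> carrier H. f ` {x} \<subseteq> U}"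
      using assms that by (intro openin_HT) auto
    with assms(1) f that(2) have "\<forall>\<^sub>F i in F. \<phi> i \<in> {f \<in> carrier H. f ` {x} \<subseteq> U}"
      unfolding limitin_def by auto
    then show ?thesis by (auto elim: eventually_mono)
  qed
  then show ?thesis
    unfolding limitin_def using H_plusD(4)[OF f assms(2)] by auto
qed

text \<open>Left translation by \<open>k\<close> only replaces the target \<open>U\<close> of a
  subbasic set by its preimage under \<open>k\<close>. This later moves neighbourhoods of the
  identity to other points of the image of the completion.\<close>

lemma continuous_map_HT_compose:
  assumes k: "k \<in> carrier H"
  shows "continuous_map HT HT (compose K k)"
  unfolding H_plus_topology_def[of K r] compact_open_topology_def
proof (rule continuous_on_generated_topo,
    unfold compact_open_topology_def[symmetric] H_plus_topology_def[of K r, symmetric], goal_cases)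
  case (1 N)
  then obtain C U where N: "N = {f \<in> carrier H. f ` C \<subseteq> U}" "compactin X C" "openin X U" by blast
  have C: "C \<subseteq> K"
    using N(2) compactin_subset_topspace by fastforce
  have "compose K k -` N \<inter> topspace HT
      = {f \<in> carrier H. f ` C \<subseteq> {x \<in> topspace X. k x \<in> U}}"
  proof -
    have "compose K k f \<in> N \<longleftrightarrow> f ` C \<subseteq> {x \<in> topspace X. k x \<in> U}" if "f \<in> carrier H" for f
    proof -
      have "f x \<in> K" "compose K k f x = k (f x)" if "x \<in> C" for x
        using that C H_plusD(4)[OF \<open>f \<in> carrier H\<close>] by (auto simp: compose_eq)
      then show ?thesis
        unfolding N(1) using compose_H[OF k that] by (simp add: image_subset_iff)
    qed
    then show ?thesis
      unfolding topspace_HT by blast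
  qed
  moreover have "openin X {x \<in> topspace X. k x \<in> U}"
    using openin_continuous_map_preimage H_plusD(3)[OF k] N(3) by blast
  ultimately show ?case
    using openin_HT[OF N(2)] by simp
next
  case 2
  have "compactin X {} \<and> openin X {}" by simp
  then show ?case
    using compose_H[OF k] topspace_HT
    unfolding H_plus_topology_def compact_open_topology_def topology_generated_by_topspace by blast
qed

section \<open>Completeness of \<open>H_plus\<close>\<close>

text \<open>The index set and filter are left arbitrary, and the inverses form an explicit family
  \<open>\<psi>\<close>, because the application indexes by elements \<open>g\<close> of
  \<open>G\<close> along a trace filter, with \<open>\<psi> g\<close> being \<open>\<phi>\<close> of
  the inverse of \<open>g\<close>.\<close>

theorem H_plus_complete:
  assumes F: "F \<noteq> bot"
    and H: "\<forall>\<^sub>F i in F. \<phi> i \<in> carrier H \<and> \<psi> i \<in> carrier H \<and>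
      (\<forall>x\<in>K. \<phi> i (\<psi> i x) = x \<and> \<psi> i (\<phi> i x) = x)"
    and cauchy: "quotients_tend_to_id X F \<phi> \<psi>" "quotients_tend_to_id X F \<psi> \<phi>"
  obtains f where "limitin HT \<phi> f F"
proof -
  have 1: "\<exists>y. limitin X (\<lambda>i. \<phi> i x) y F" if "x \<in> K" for x
  proof -
    have "\<forall>\<^sub>F i in F. \<phi> i x \<in> topspace X \<and> \<psi> i (\<phi> i x) = x"
      using H by eventually_elim (use that H_plusD(4) in auto)
    then show ?thesis
      using quotients_tend_to_id_pointwise_limit[OF compact_X Hausdorff_X F cauchy(1)] by metis
  qed
  have 2: "\<exists>y. limitin X (\<lambda>i. \<psi> i x) y F" if "x \<in> K" for x
  proof -
    have "\<forall>\<^sub>F i in F. \<psi> i x \<in> topspace X \<and> \<phi> i (\<psi> i x) = x"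
      using H by eventually_elim (use that H_plusD(4) in auto)
    then show ?thesis
      using quotients_tend_to_id_pointwise_limit[OF compact_X Hausdorff_X F cauchy(2)] by metis
  qed
  define f where "f = (\<lambda>x\<in>K. SOME y. limitin X (\<lambda>i. \<phi> i x) y F)"
  define g where "g = (\<lambda>x\<in>K. SOME y. limitin X (\<lambda>i. \<psi> i x) y F)"
  have f: "limitin X (\<lambda>i. \<phi> i x) (f x) F" and g: "limitin X (\<lambda>i. \<psi> i x) (g x) F"
    if "x \<in> K" for x
    using someI_ex[OF 1[OF that]] someI_ex[OF 2[OF that]] that by (simp_all add: f_def g_def)
  have fK: "f \<in> K \<rightarrow> K" and gK: "g \<in> K \<rightarrow> K"
    using f g limitin_topspace by force+
  have cont: "\<forall>\<^sub>F i in F. continuous_map X X (\<phi> i)" "\<forall>\<^sub>F i in F. continuous_map X X (\<psi> i)"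
    using H by (eventually_elim, use H_plusD(3) in blast)+
  \<comment> \<open>The family \<open>\<psi> i (f x)\<close> has two limits: \<open>x\<close> by the
    Cauchy condition, and \<open>g (f x)\<close> by the choice of \<open>g\<close>.\<close>
  have gf: "g (f x) = x" if x: "x \<in> K" for x
  proof (rule limitin_Hausdorff_unique[OF _ _ _ Hausdorff_X])
    have "\<forall>\<^sub>F i in F. \<forall>y\<in>{x}. \<psi> i (f y) \<in> U" if "openin X U" "x \<in> U" for U
      using that x f by (intro quotients_tend_to_id_limit[OF compact_X Hausdorff_X F cauchy(2) cont(2)]) auto
    then show "limitin X (\<lambda>i. \<psi> i (f x)) x F"
      unfolding limitin_def using x by auto
    show "limitin X (\<lambda>i. \<psi> i (f x)) (g (f x)) F"
      using g fK x by auto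
  qed (use F in auto)
  have fg: "f (g x) = x" if x: "x \<in> K" for x
  proof (rule limitin_Hausdorff_unique[OF _ _ _ Hausdorff_X])
    have "\<forall>\<^sub>F i in F. \<forall>y\<in>{x}. \<phi> i (g y) \<in> U" if "openin X U" "x \<in> U" for U
      using that x g by (intro quotients_tend_to_id_limit[OF compact_X Hausdorff_X F cauchy(1) cont(1)]) auto
    then show "limitin X (\<lambda>i. \<phi> i (g x)) x F"
      unfolding limitin_def using x by auto
    show "limitin X (\<lambda>i. \<phi> i (g x)) (f (g x)) F"
      using f gK x by auto
  qed (use F in auto)
  have fH: "f \<in> carrier H"
  proof (rule H_plusI[OF fK gK])
    show "f \<in> extensional K" by (simp add: f_def)
    fix x y assume xy: "(x, y) \<in> r" "x \<in> K" "y \<in> K"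
    have "\<forall>\<^sub>F i in F. (\<phi> i x, \<phi> i y) \<in> r" "\<forall>\<^sub>F i in F. (\<psi> i x, \<psi> i y) \<in> r"
      using H by (eventually_elim, use xy H_plusD(5) in blast)+
    then show "(f x, f y) \<in> r" "(g x, g y) \<in> r"
      using limit_mono[OF F] f g xy by blast+
  qed (use fg gf in auto)
  have "limitin HT \<phi> f F"
    unfolding H_plus_topology_def compact_open_topology_def
  proof (rule limitin_topology_generated_by)
    show "f \<in> \<Union> {{f \<in> carrier H. f ` C \<subseteq> U} |C U. compactin X C \<and> openin X U}"
      using fH topspace_HT
      unfolding H_plus_topology_def compact_open_topology_def topology_generated_by_topspace by blast
  next
    fix N assume "N \<in> {{f \<in> carrier H. f ` C \<subseteq> U} |C U. compactin X C \<and> openin X U}" "f \<in> N"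
    then obtain C U where N: "N = {f \<in> carrier H. f ` C \<subseteq> U}" and
      C: "compactin X C" and U: "openin X U" and sub: "f ` C \<subseteq> U"
      by blast
    have "C \<subseteq> K"
      using C compactin_subset_topspace by fastforce
    \<comment> \<open>At \<open>y = f x\<close> the value \<open>\<phi> i (g y)\<close> is
      \<open>\<phi> i x\<close>, so uniform control over the compact image of \<open>C\<close> under
      \<open>f\<close> is uniform control over \<open>C\<close> itself.\<close>
    have "\<forall>\<^sub>F i in F. \<forall>y\<in>f ` C. \<phi> i (g y) \<in> U"
    proof (rule quotients_tend_to_id_limit[OF compact_X Hausdorff_X F cauchy(1) cont(1)])
      show "compactin X (f ` C)"
        using image_compactin C H_plusD(3)[OF fH] by blast
      show "limitin X (\<lambda>j. \<psi> j y) (g y) F" if "y \<in> f ` C" for y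
        using that g fK \<open>C \<subseteq> K\<close> by (auto simp: Pi_iff)
    qed (use U sub in auto)
    then have "\<forall>\<^sub>F i in F. \<forall>x\<in>C. \<phi> i x \<in> U"
      using gf \<open>C \<subseteq> K\<close> by (simp add: subset_iff)
    with H show "\<forall>\<^sub>F i in F. \<phi> i \<in> N"
      by eventually_elim (simp add: N image_subset_iff)
  qed
  then show thesis using that by blast
qed

end


section \<open>Topological groups\<close>

lemma continuous_map_prod_neighbourhood:
  assumes "continuous_map (prod_topology S T) Z (\<lambda>(x, y). f x y)"
    "x \<in> topspace S" "y \<in> topspace T" "openin Z W" "f x y \<in> W"
  obtains U V where "openin S U" "openin T V" "x \<in> U" "y \<in> V"
    "\<And>u v. u \<in> U \<Longrightarrow> v \<in> V \<Longrightarrow> f u v \<in> W"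
proof -
  define E where "E = {p \<in> topspace (prod_topology S T). (\<lambda>(x, y). f x y) p \<in> W}"
  have "openin (prod_topology S T) E"
    unfolding E_def using openin_continuous_map_preimage[OF assms(1,4)] .
  moreover have "(x, y) \<in> E"
    using assms by (simp add: E_def)
  ultimately have "\<exists>U V. openin S U \<and> openin T V \<and> x \<in> U \<and> y \<in> V \<and> U \<times> V \<subseteq> E"
    by (simp add: openin_prod_topology_alt)
  then obtain U V where UV: "openin S U" "openin T V" "x \<in> U" "y \<in> V" "U \<times> V \<subseteq> E"
    by blast
  then have "f u v \<in> W" if "u \<in> U" "v \<in> V" for u v
    using that by (auto simp: E_def)
  with UV(1-4) that show thesis by blast
qed

lemma topological_groupD:
  assumes "topological_group G T"
  shows "group G" "topspace T = carrier G"
    "continuous_map (prod_topology T T) T (\<lambda>(x, y). x \<otimes>\<^bsub>G\<^esub> y)"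
    "continuous_map T T (\<lambda>x. inv\<^bsub>G\<^esub> x)"
    "continuous_map (prod_topology T T) T (\<lambda>(x, y). x \<otimes>\<^bsub>G\<^esub> inv\<^bsub>G\<^esub> y)"
    "continuous_map (prod_topology T T) T (\<lambda>(x, y). inv\<^bsub>G\<^esub> x \<otimes>\<^bsub>G\<^esub> y)"
proof -
  show "group G" "topspace T = carrier G"
    and m: "continuous_map (prod_topology T T) T (\<lambda>(x, y). x \<otimes>\<^bsub>G\<^esub> y)"
    and i: "continuous_map T T (\<lambda>x. inv\<^bsub>G\<^esub> x)"
    using assms unfolding topological_group_def by simp_all
  have "continuous_map (prod_topology T T) (prod_topology T T) (\<lambda>(x, y). (x, inv\<^bsub>G\<^esub> y))"
    using i by (simp add: continuous_map_prod_top)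
  from continuous_map_compose[OF this m]
  show "continuous_map (prod_topology T T) T (\<lambda>(x, y). x \<otimes>\<^bsub>G\<^esub> inv\<^bsub>G\<^esub> y)"
    by (simp add: o_def case_prod_unfold)
  have "continuous_map (prod_topology T T) (prod_topology T T) (\<lambda>(x, y). (inv\<^bsub>G\<^esub> x, y))"
    using i by (simp add: continuous_map_prod_top)
  from continuous_map_compose[OF this m]
  show "continuous_map (prod_topology T T) T (\<lambda>(x, y). inv\<^bsub>G\<^esub> x \<otimes>\<^bsub>G\<^esub> y)"
    by (simp add: o_def case_prod_unfold)
qed

definition group_entourage :: "('a, 'm) monoid_scheme \<Rightarrow> 'a set \<Rightarrow> ('a \<times> 'a) set" where
  "group_entourage G U = {(x, y). x \<in> carrier G \<and> y \<in> carrier G \<and>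
     inv\<^bsub>G\<^esub> x \<otimes>\<^bsub>G\<^esub> y \<in> U \<and> x \<otimes>\<^bsub>G\<^esub> inv\<^bsub>G\<^esub> y \<in> U}"

text \<open>The defining infimum is over a directed family, since the entourage of
  \<open>U \<inter> V\<close> lies in those of \<open>U\<close> and of \<open>V\<close>; hence the
  basic entourages form a filter base.\<close>

lemma eventually_two_sided_uniformity:
  assumes "topological_group G T"
  shows "eventually P (two_sided_uniformity G T) \<longleftrightarrow>
    (\<exists>U. openin T U \<and> \<one>\<^bsub>G\<^esub> \<in> U \<and> (\<forall>p\<in>group_entourage G U. P p))"
proof -
  have "openin T (carrier G)" "\<one>\<^bsub>G\<^esub> \<in> carrier G"
    using topological_groupD(1,2)[OF assms] openin_topspace group.is_monoid monoid.one_closed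
    by metis+
  then have ne: "{U. openin T U \<and> \<one>\<^bsub>G\<^esub> \<in> U} \<noteq> {}"
    by blast
  have inter: "\<exists>W\<in>{U. openin T U \<and> \<one>\<^bsub>G\<^esub> \<in> U}. principal (group_entourage G W)
      \<le> inf (principal (group_entourage G U)) (principal (group_entourage G V))"
    if "U \<in> {U. openin T U \<and> \<one>\<^bsub>G\<^esub> \<in> U}" "V \<in> {U. openin T U \<and> \<one>\<^bsub>G\<^esub> \<in> U}" for U V
  proof
    show "U \<inter> V \<in> {U. openin T U \<and> \<one>\<^bsub>G\<^esub> \<in> U}"
      using that by auto
  qed (auto simp: group_entourage_def)
  show ?thesis
    unfolding two_sided_uniformity_def group_entourage_def[symmetric]
    by (subst eventually_INF_base[OF ne inter]) (auto simp: eventually_principal)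
qed

text \<open>Recovers neighbourhoods of the unit from the uniformity. For a pair whose first entry is
  the unit, the two quotients are \<open>y\<close> and its inverse, which is why \<open>U\<close> is
  intersected with its preimage under inversion.\<close>

lemma eventually_two_sided_uniformity_one:
  assumes G: "topological_group G T" and P: "eventually P (two_sided_uniformity G T)"
  obtains U where "openin T U" "\<one>\<^bsub>G\<^esub> \<in> U" "\<And>y. y \<in> U \<Longrightarrow> P (\<one>\<^bsub>G\<^esub>, y)"
proof -
  interpret group G using topological_groupD(1)[OF G] .
  obtain U where U: "openin T U" "\<one>\<^bsub>G\<^esub> \<in> U" "\<And>p. p \<in> group_entourage G U \<Longrightarrow> P p"
    using P unfolding eventually_two_sided_uniformity[OF G] by blast
  define V where "V = U \<inter> {x \<in> topspace T. inv\<^bsub>G\<^esub> x \<in> U}"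
  show thesis
  proof
    show "openin T V"
      unfolding V_def
      by (intro openin_Int U(1) openin_continuous_map_preimage[OF topological_groupD(4)[OF G]])
    show "\<one>\<^bsub>G\<^esub> \<in> V"
      using U(2) topological_groupD(2)[OF G] by (simp add: V_def)
    fix y assume "y \<in> V"
    then show "P (\<one>\<^bsub>G\<^esub>, y)"
      using topological_groupD(2)[OF G] by (intro U(3)) (simp add: V_def group_entourage_def)
  qed
qed


section \<open>Extension to the completion\<close>

locale orderly_completion = compact_lots K r
  for K :: "'k set" and r :: "'k rel" +
  fixes G :: "('a, 'm) monoid_scheme" and T :: "'a topology"
    and G' :: "('b, 'n) monoid_scheme" and T' :: "'b topology"
    and \<iota> :: "'a \<Rightarrow> 'b" and \<phi> :: "'a \<Rightarrow> 'k \<Rightarrow> 'k"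
  assumes G: "topological_group G T" and completion: "is_raikov_completion G T G' T' \<iota>"
    and \<phi>: "\<phi> \<in> mon G H" "embedding_map T HT \<phi>"
begin

lemma G': "topological_group G' T'" and Hausdorff: "Hausdorff_space T'"
  and \<iota>: "\<iota> \<in> hom G G'" and dense: "T' closure_of (\<iota> ` carrier G) = carrier G'"
  and uniformity: "two_sided_uniformity G T =
    inf (filtercomap (map_prod \<iota> \<iota>) (two_sided_uniformity G' T'))
        (principal (carrier G \<times> carrier G))"
  using completion unfolding is_raikov_completion_def mon_def by auto

interpretation G: group G
  using topological_groupD(1)[OF G] .

interpretation G': group G'
  using topological_groupD(1)[OF G'] .

lemma topspace_T [simp]: "topspace T = carrier G" and topspace_T' [simp]: "topspace T' = carrier G'"
  using topological_groupD(2) G G' by blast+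

lemma \<iota>_closed [simp]: "g \<in> carrier G \<Longrightarrow> \<iota> g \<in> carrier G'"
  using \<iota> by (auto simp: hom_def)

lemma \<iota>_one [simp]: "\<iota> \<one>\<^bsub>G\<^esub> = \<one>\<^bsub>G'\<^esub>"
  using hom_one[OF \<iota> G.is_group G'.is_group] .

lemma \<iota>_mult: "g \<in> carrier G \<Longrightarrow> h \<in> carrier G \<Longrightarrow> \<iota> (g \<otimes>\<^bsub>G\<^esub> h) = \<iota> g \<otimes>\<^bsub>G'\<^esub> \<iota> h"
  using hom_mult[OF \<iota>] .

lemma \<iota>_inv: "g \<in> carrier G \<Longrightarrow> \<iota> (inv\<^bsub>G\<^esub> g) = inv\<^bsub>G'\<^esub> \<iota> g"
  using \<iota> G.is_group G'.is_group by (intro group_hom.hom_inv group_hom.intro group_hom_axioms.intro)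

text \<open>One half of the equation \<open>uniformity\<close>, evaluated at pairs of the unit and
  \<open>g\<close>. It lets smallness in \<open>G\<close> be tested in the completion, which is what
  makes \<open>\<phi>\<close> Cauchy along trace filters.\<close>

lemma \<iota>_initial:
  assumes "openin T V" "\<one>\<^bsub>G\<^esub> \<in> V"
  obtains U where "openin T' U" "\<one>\<^bsub>G'\<^esub> \<in> U" "\<And>g. g \<in> carrier G \<Longrightarrow> \<iota> g \<in> U \<Longrightarrow> g \<in> V"
proof -
  have "eventually (\<lambda>p. p \<in> group_entourage G V) (two_sided_uniformity G T)"
    unfolding eventually_two_sided_uniformity[OF G] using assms by blast
  then obtain Q where Q: "eventually Q (two_sided_uniformity G' T')"
    "\<And>p. Q (map_prod \<iota> \<iota> p) \<Longrightarrow> p \<in> carrier G \<times> carrier G \<Longrightarrow> p \<in> group_entourage G V"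
    unfolding uniformity eventually_inf_principal eventually_filtercomap by blast
  obtain U where U: "openin T' U" "\<one>\<^bsub>G'\<^esub> \<in> U" "\<And>y. y \<in> U \<Longrightarrow> Q (\<one>\<^bsub>G'\<^esub>, y)"
    using eventually_two_sided_uniformity_one[OF G' Q(1)] by blast
  have "g \<in> V" if g: "g \<in> carrier G" "\<iota> g \<in> U" for g
    using Q(2)[of "(\<one>\<^bsub>G\<^esub>, g)"] U(3)[OF g(2)] g(1) by (simp add: group_entourage_def)
  with U(1,2) that show thesis by blast
qed

text \<open>The other half of \<open>uniformity\<close>: continuity of \<open>\<iota>\<close> at the
  unit. It serves the openness of the extension.\<close>

lemma \<iota>_continuous_one:
  assumes "openin T' U" "\<one>\<^bsub>G'\<^esub> \<in> U"
  obtains V where "openin T V" "\<one>\<^bsub>G\<^esub> \<in> V" "\<And>g. g \<in> V \<Longrightarrow> \<iota> g \<in> U"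
proof -
  have "eventually (\<lambda>p. p \<in> group_entourage G' U) (two_sided_uniformity G' T')"
    unfolding eventually_two_sided_uniformity[OF G'] using assms by blast
  then have "eventually (\<lambda>p. map_prod \<iota> \<iota> p \<in> group_entourage G' U) (two_sided_uniformity G T)"
    unfolding uniformity eventually_inf_principal eventually_filtercomap by blast
  then obtain V where V: "openin T V" "\<one>\<^bsub>G\<^esub> \<in> V"
    "\<And>y. y \<in> V \<Longrightarrow> map_prod \<iota> \<iota> (\<one>\<^bsub>G\<^esub>, y) \<in> group_entourage G' U"
    by (rule eventually_two_sided_uniformity_one[OF G]) blast
  have "\<iota> g \<in> U" if "g \<in> V" for g
    using V(3)[OF that] by (auto simp: group_entourage_def)
  with V(1,2) that show thesis by blast
qed

lemma \<phi>_closed [simp]: "g \<in> carrier G \<Longrightarrow> \<phi> g \<in> carrier H"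
  using \<phi>(1) by (auto simp: mon_def hom_def)

lemma \<phi>_mult: "g \<in> carrier G \<Longrightarrow> h \<in> carrier G \<Longrightarrow> \<phi> (g \<otimes>\<^bsub>G\<^esub> h) = compose K (\<phi> g) (\<phi> h)"
  using \<phi>(1) mult_H by (auto simp: mon_def hom_def)

lemma \<phi>_one: "\<phi> \<one>\<^bsub>G\<^esub> = (\<lambda>x\<in>K. x)"
  using idempotent_H \<phi>_mult[of "\<one>\<^bsub>G\<^esub>" "\<one>\<^bsub>G\<^esub>"] by simp

lemma \<phi>_inverse:
  assumes "g \<in> carrier G" "x \<in> K"
  shows "\<phi> g (\<phi> (inv\<^bsub>G\<^esub> g) x) = x" "\<phi> (inv\<^bsub>G\<^esub> g) (\<phi> g x) = x"
proof -
  have "compose K (\<phi> g) (\<phi> (inv\<^bsub>G\<^esub> g)) = (\<lambda>x\<in>K. x)" "compose K (\<phi> (inv\<^bsub>G\<^esub> g)) (\<phi> g) = (\<lambda>x\<in>K. x)"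
    using assms(1) \<phi>_mult[of g "inv\<^bsub>G\<^esub> g"] \<phi>_mult[of "inv\<^bsub>G\<^esub> g" g] \<phi>_one by simp_all
  then show "\<phi> g (\<phi> (inv\<^bsub>G\<^esub> g) x) = x" "\<phi> (inv\<^bsub>G\<^esub> g) (\<phi> g x) = x"
    using assms(2) by (metis compose_eq restrict_apply')+
qed

lemma \<phi>_continuous: "continuous_map T HT \<phi>"
  using homeomorphic_imp_continuous_map[OF \<phi>(2)[unfolded embedding_map_def]]
  by (simp add: continuous_map_in_subtopology)

section \<open>Trace filters on \<open>G\<close> of points of the completion\<close>

definition trace_filter :: "'b \<Rightarrow> 'a filter" where
  "trace_filter y = inf (filtercomap \<iota> (nhdsin T' y)) (principal (carrier G))"

lemma eventually_trace:
  assumes "y \<in> carrier G'"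
  shows "eventually P (trace_filter y) \<longleftrightarrow>
    (\<exists>U. openin T' U \<and> y \<in> U \<and> (\<forall>g\<in>carrier G. \<iota> g \<in> U \<longrightarrow> P g))"
proof -
  have "eventually P (trace_filter y) \<longleftrightarrow> (\<exists>Q. (\<exists>U. openin T' U \<and> y \<in> U \<and> (\<forall>z\<in>U. Q z)) \<and>
      (\<forall>g. Q (\<iota> g) \<longrightarrow> g \<in> carrier G \<longrightarrow> P g))"
    unfolding trace_filter_def eventually_inf_principal eventually_filtercomap eventually_nhdsin
    using assms by simp
  also have "\<dots> \<longleftrightarrow> (\<exists>U. openin T' U \<and> y \<in> U \<and> (\<forall>g\<in>carrier G. \<iota> g \<in> U \<longrightarrow> P g))"
    (is "?l \<longleftrightarrow> ?r")
  proof
    show "?l \<Longrightarrow> ?r" by blast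
    assume ?r
    then obtain U where "openin T' U" "y \<in> U" "\<forall>g\<in>carrier G. \<iota> g \<in> U \<longrightarrow> P g" by blast
    then show ?l by (intro exI[of _ "\<lambda>z. z \<in> U"]) blast
  qed
  finally show ?thesis .
qed

lemma eventually_trace_carrier: "eventually (\<lambda>g. g \<in> carrier G) (trace_filter y)"
  unfolding trace_filter_def eventually_inf_principal by simp

lemma trace_neq_bot:
  assumes "y \<in> carrier G'"
  shows "trace_filter y \<noteq> bot"
proof
  assume "trace_filter y = bot"
  then have "eventually (\<lambda>_. False) (trace_filter y)" by simp
  then obtain U where "openin T' U" "y \<in> U" "\<forall>g\<in>carrier G. \<iota> g \<notin> U"
    unfolding eventually_trace[OF assms] by blast
  moreover have "y \<in> T' closure_of (\<iota> ` carrier G)"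
    using dense assms by simp
  ultimately show False
    unfolding in_closure_of by blast
qed

text \<open>When \<open>\<iota> g\<close> and \<open>\<iota> h\<close> are both near
  \<open>y\<close>, their left and right quotients are near the unit, by continuity of the two
  division maps at the pair of \<open>y\<close> with itself. \<open>\<iota>_initial\<close> brings
  this back to \<open>G\<close>, and continuity of \<open>\<phi>\<close> carries it into
  \<open>H_plus\<close>.\<close>

lemma quotients_tend_to_id_trace:
  assumes y: "y \<in> carrier G'"
  shows "quotients_tend_to_id X (trace_filter y) \<phi> (\<lambda>g. \<phi> (inv\<^bsub>G\<^esub> g))"
    "quotients_tend_to_id X (trace_filter y) (\<lambda>g. \<phi> (inv\<^bsub>G\<^esub> g)) \<phi>"
proof -
  have "(\<forall>\<^sub>F (g, h) in trace_filter y \<times>\<^sub>F trace_filter y. \<forall>x\<in>C. \<phi> g (\<phi> (inv\<^bsub>G\<^esub> h) x) \<in> U) \<and>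
    (\<forall>\<^sub>F (g, h) in trace_filter y \<times>\<^sub>F trace_filter y. \<forall>x\<in>C. \<phi> (inv\<^bsub>G\<^esub> g) (\<phi> h x) \<in> U)"
    if C: "compactin X C" "openin X U" "C \<subseteq> U" for C U
  proof -
    have CK: "C \<subseteq> K"
      using compactin_subset_topspace[OF C(1)] by simp
    \<comment> \<open>The unit lies in \<open>V\<close> because \<open>\<phi>\<close> sends it to
      the identity and \<open>C \<subseteq> U\<close>.\<close>
    define V where "V = {g \<in> topspace T. \<phi> g \<in> {f \<in> carrier H. f ` C \<subseteq> U}}"
    have "openin T V"
      unfolding V_def using openin_continuous_map_preimage[OF \<phi>_continuous openin_HT[OF C(1,2)]] .
    moreover have "\<one>\<^bsub>G\<^esub> \<in> V"
      using \<phi>_closed[OF G.one_closed] CK C(3) by (auto simp: V_def \<phi>_one)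
    ultimately obtain O1 where O1: "openin T' O1" "\<one>\<^bsub>G'\<^esub> \<in> O1"
      "\<And>g. g \<in> carrier G \<Longrightarrow> \<iota> g \<in> O1 \<Longrightarrow> g \<in> V"
      by (rule \<iota>_initial) blast
    have V: "\<forall>x\<in>C. \<phi> g (\<phi> h x) \<in> U"
      if "g \<in> carrier G" "h \<in> carrier G" "\<iota> g \<otimes>\<^bsub>G'\<^esub> \<iota> h \<in> O1" for g h
    proof
      fix x assume x: "x \<in> C"
      have "g \<otimes>\<^bsub>G\<^esub> h \<in> V"
        using that \<iota>_mult by (intro O1(3)) auto
      then have "compose K (\<phi> g) (\<phi> h) x \<in> U"
        using x that \<phi>_mult by (auto simp: V_def)
      then show "\<phi> g (\<phi> h x) \<in> U"
        using x CK by (auto simp: compose_eq)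
    qed
    have ev: "\<forall>\<^sub>F (g, h) in trace_filter y \<times>\<^sub>F trace_filter y. P g h"
      if W: "openin T' W1" "openin T' W2" "y \<in> W1" "y \<in> W2"
        "\<And>g h. g \<in> carrier G \<Longrightarrow> h \<in> carrier G \<Longrightarrow> \<iota> g \<in> W1 \<Longrightarrow> \<iota> h \<in> W2 \<Longrightarrow> P g h" for P W1 W2
      unfolding eventually_prod_filter
    proof (intro exI conjI allI impI)
      show "\<forall>\<^sub>F g in trace_filter y. g \<in> carrier G \<and> \<iota> g \<in> W1" "\<forall>\<^sub>F h in trace_filter y. h \<in> carrier G \<and> \<iota> h \<in> W2"
        using W eventually_trace[OF y] by blast+
    qed (use W(5) in auto)
    obtain W1 W2 where W: "openin T' W1" "openin T' W2" "y \<in> W1" "y \<in> W2"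
      "\<And>u v. u \<in> W1 \<Longrightarrow> v \<in> W2 \<Longrightarrow> u \<otimes>\<^bsub>G'\<^esub> inv\<^bsub>G'\<^esub> v \<in> O1"
      by (rule continuous_map_prod_neighbourhood[OF topological_groupD(5)[OF G'], of y y O1])
        (use y O1 in auto)
    have 1: "\<forall>\<^sub>F (g, h) in trace_filter y \<times>\<^sub>F trace_filter y. \<forall>x\<in>C. \<phi> g (\<phi> (inv\<^bsub>G\<^esub> h) x) \<in> U"
      by (rule ev[OF W(1-4)], rule V) (use W(5) \<iota>_inv in auto)
    obtain W1 W2 where W: "openin T' W1" "openin T' W2" "y \<in> W1" "y \<in> W2"
      "\<And>u v. u \<in> W1 \<Longrightarrow> v \<in> W2 \<Longrightarrow> inv\<^bsub>G'\<^esub> u \<otimes>\<^bsub>G'\<^esub> v \<in> O1"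
      by (rule continuous_map_prod_neighbourhood[OF topological_groupD(6)[OF G'], of y y O1])
        (use y O1 in auto)
    have "\<forall>\<^sub>F (g, h) in trace_filter y \<times>\<^sub>F trace_filter y. \<forall>x\<in>C. \<phi> (inv\<^bsub>G\<^esub> g) (\<phi> h x) \<in> U"
      by (rule ev[OF W(1-4)], rule V) (use W(5) \<iota>_inv in auto)
    with 1 show ?thesis ..
  qed
  then show "quotients_tend_to_id X (trace_filter y) \<phi> (\<lambda>g. \<phi> (inv\<^bsub>G\<^esub> g))"
    "quotients_tend_to_id X (trace_filter y) (\<lambda>g. \<phi> (inv\<^bsub>G\<^esub> g)) \<phi>"
    unfolding quotients_tend_to_id_def by blast+
qed

section \<open>The extension \<open>\<Phi>\<close>: multiplicativity and continuity\<close>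

definition \<Phi> :: "'b \<Rightarrow> 'k \<Rightarrow> 'k" where
  "\<Phi> y = (SOME f. limitin HT \<phi> f (trace_filter y))"

lemma \<Phi>_limit:
  assumes "y \<in> carrier G'"
  shows "limitin HT \<phi> (\<Phi> y) (trace_filter y)"
proof -
  have "\<forall>\<^sub>F g in trace_filter y. \<phi> g \<in> carrier H \<and> \<phi> (inv\<^bsub>G\<^esub> g) \<in> carrier H \<and>
      (\<forall>x\<in>K. \<phi> g (\<phi> (inv\<^bsub>G\<^esub> g) x) = x \<and> \<phi> (inv\<^bsub>G\<^esub> g) (\<phi> g x) = x)"
    using eventually_trace_carrier by eventually_elim (simp add: \<phi>_inverse)
  then obtain f where "limitin HT \<phi> f (trace_filter y)"
    using H_plus_complete[OF trace_neq_bot[OF assms] _ quotients_tend_to_id_trace[OF assms]] by blast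
  then show ?thesis
    unfolding \<Phi>_def by (rule someI[of "\<lambda>f. limitin HT \<phi> f (trace_filter y)"])
qed

lemma \<Phi>_closed [simp]: "y \<in> carrier G' \<Longrightarrow> \<Phi> y \<in> carrier H"
  using limitin_topspace[OF \<Phi>_limit] by simp

lemma \<Phi>_neighbourhood:
  assumes "y \<in> carrier G'" "openin HT N" "\<Phi> y \<in> N"
  shows "\<forall>\<^sub>F g in trace_filter y. \<phi> g \<in> N"
  using \<Phi>_limit[OF assms(1)] assms(2,3) unfolding limitin_def by simp

text \<open>Both sides are limits of \<open>\<phi> g (\<phi> h p)\<close> along the product of the
  two trace filters: the left one by continuity of the multiplication of \<open>G'\<close>, the
  right one by joint continuity of evaluation.\<close>

lemma \<Phi>_mult_apply:
  assumes x: "x \<in> carrier G'" and y: "y \<in> carrier G'" and p: "p \<in> K"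
  shows "\<Phi> (x \<otimes>\<^bsub>G'\<^esub> y) p = \<Phi> x (\<Phi> y p)"
proof (rule limitin_Hausdorff_unique[OF _ _ _ Hausdorff_X])
  let ?F = "trace_filter x \<times>\<^sub>F trace_filter y"
  let ?f = "\<lambda>(g, h). \<phi> g (\<phi> h p)"
  have xy: "x \<otimes>\<^bsub>G'\<^esub> y \<in> carrier G'" and q: "\<Phi> y p \<in> K" and xq: "\<Phi> x (\<Phi> y p) \<in> K"
    using x y p H_plusD(4) by auto
  have "limitin HT (\<lambda>(g, h). \<phi> (g \<otimes>\<^bsub>G\<^esub> h)) (\<Phi> (x \<otimes>\<^bsub>G'\<^esub> y)) ?F"
    unfolding limitin_def
  proof (intro conjI allI impI)
    show "\<Phi> (x \<otimes>\<^bsub>G'\<^esub> y) \<in> topspace HT"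
      using xy by simp
    fix N assume "openin HT N \<and> \<Phi> (x \<otimes>\<^bsub>G'\<^esub> y) \<in> N"
    then have "\<forall>\<^sub>F g in trace_filter (x \<otimes>\<^bsub>G'\<^esub> y). \<phi> g \<in> N"
      by (intro \<Phi>_neighbourhood xy) auto
    then obtain W where W: "openin T' W" "x \<otimes>\<^bsub>G'\<^esub> y \<in> W" "\<forall>g\<in>carrier G. \<iota> g \<in> W \<longrightarrow> \<phi> g \<in> N"
      unfolding eventually_trace[OF xy] by blast
    obtain U V where UV: "openin T' U" "openin T' V" "x \<in> U" "y \<in> V"
      "\<And>u v. u \<in> U \<Longrightarrow> v \<in> V \<Longrightarrow> u \<otimes>\<^bsub>G'\<^esub> v \<in> W"
      by (rule continuous_map_prod_neighbourhood[OF topological_groupD(3)[OF G'], of x y W])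
        (use x y W in auto)
    have "\<forall>\<^sub>F g in trace_filter x. g \<in> carrier G \<and> \<iota> g \<in> U" "\<forall>\<^sub>F h in trace_filter y. h \<in> carrier G \<and> \<iota> h \<in> V"
      unfolding eventually_trace[OF x] eventually_trace[OF y] using UV by blast+
    from eventually_prodI[OF this] show "\<forall>\<^sub>F p in ?F. (case p of (g, h) \<Rightarrow> \<phi> (g \<otimes>\<^bsub>G\<^esub> h)) \<in> N"
      by eventually_elim (use UV(5) W(3) \<iota>_mult in auto)
  qed
  from limitin_HT_pointwise[OF this p]
  have "limitin X (\<lambda>i. (case i of (g, h) \<Rightarrow> \<phi> (g \<otimes>\<^bsub>G\<^esub> h)) p) (\<Phi> (x \<otimes>\<^bsub>G'\<^esub> y) p) ?F" .
  moreover have "\<forall>\<^sub>F i in ?F. (case i of (g, h) \<Rightarrow> \<phi> (g \<otimes>\<^bsub>G\<^esub> h)) p = ?f i"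
    using eventually_prodI[OF eventually_trace_carrier[of x] eventually_trace_carrier[of y]]
    by eventually_elim (use \<phi>_mult p in \<open>auto simp: compose_eq\<close>)
  ultimately show "limitin X ?f (\<Phi> (x \<otimes>\<^bsub>G'\<^esub> y) p) ?F"
    by (rule limitin_transform_eventually[rotated])
  show "limitin X ?f (\<Phi> x (\<Phi> y p)) ?F"
    unfolding limitin_def
  proof (intro conjI allI impI)
    show "\<Phi> x (\<Phi> y p) \<in> topspace X"
      using xq by simp
    fix W assume W: "openin X W \<and> \<Phi> x (\<Phi> y p) \<in> W"
    have "openin X {z \<in> topspace X. \<Phi> x z \<in> W}"
      using openin_continuous_map_preimage[OF H_plusD(3)] x W by auto
    \<comment> \<open>Joint continuity needs a compact neighbourhood of \<open>\<Phi> y p\<close>: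
      eventually \<open>\<phi> g\<close> maps all of the closure of \<open>V\<close> into
      \<open>W\<close>, while \<open>\<phi> h p\<close> lies in \<open>V\<close>, independently of
      \<open>g\<close>.\<close>
    then have "\<exists>V. openin X V \<and> {\<Phi> y p} \<subseteq> V \<and> X closure_of V \<subseteq> {z \<in> topspace X. \<Phi> x z \<in> W}"
      using q W by (intro compact_Hausdorff_shrink[OF compact_X Hausdorff_X]) auto
    then obtain V where V: "openin X V" "\<Phi> y p \<in> V"
      "X closure_of V \<subseteq> {z \<in> topspace X. \<Phi> x z \<in> W}"
      by blast
    have "compactin X (X closure_of V)"
      using compact_X by (simp add: closedin_compact_space)
    then have "openin HT {f \<in> carrier H. f ` (X closure_of V) \<subseteq> W}"
      using W by (intro openin_HT) auto
    then have "\<forall>\<^sub>F g in trace_filter x. \<phi> g \<in> {f \<in> carrier H. f ` (X closure_of V) \<subseteq> W}"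
      using x V(3) by (intro \<Phi>_neighbourhood) auto
    moreover have "\<forall>\<^sub>F h in trace_filter y. \<phi> h p \<in> V"
      using limitin_HT_pointwise[OF \<Phi>_limit[OF y] p] V unfolding limitin_def by blast
    ultimately have "\<forall>\<^sub>F i in ?F. \<phi> (fst i) \<in> {f \<in> carrier H. f ` (X closure_of V) \<subseteq> W} \<and> \<phi> (snd i) p \<in> V"
      by (rule eventually_prodI)
    then show "\<forall>\<^sub>F i in ?F. ?f i \<in> W"
      by eventually_elim
        (use closure_of_subset[OF openin_subset[OF V(1)]] in \<open>auto simp: image_subset_iff\<close>)
  qed
  show "?F \<noteq> bot"
    using trace_neq_bot x y by (simp add: prod_filter_eq_bot)
qed

lemma \<Phi>_mult:
  assumes "x \<in> carrier G'" "y \<in> carrier G'"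
  shows "\<Phi> (x \<otimes>\<^bsub>G'\<^esub> y) = compose K (\<Phi> x) (\<Phi> y)"
proof (rule extensionalityI)
  show "\<Phi> (x \<otimes>\<^bsub>G'\<^esub> y) \<in> extensional K"
    using assms H_plusD(2) by simp
qed (use assms in \<open>auto simp: compose_eq \<Phi>_mult_apply compose_extensional\<close>)

lemma \<Phi>_one: "\<Phi> \<one>\<^bsub>G'\<^esub> = (\<lambda>x\<in>K. x)"
  using idempotent_H \<Phi>_mult[of "\<one>\<^bsub>G'\<^esub>" "\<one>\<^bsub>G'\<^esub>"] by simp

text \<open>The classical extension by continuity from a dense subset, carried out on subbasic sets,
  with the shrinking of \<open>U\<close> to \<open>W\<close> in the role of regularity of the
  target.\<close>

lemma \<Phi>_continuous: "continuous_map T' HT \<Phi>"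
  unfolding H_plus_topology_def[of K r] compact_open_topology_def
proof (rule continuous_on_generated_topo, goal_cases)
  case (1 N)
  then obtain C U where N: "N = {f \<in> carrier H. f ` C \<subseteq> U}" and CU: "compactin X C" "openin X U"
    by blast
  have C: "C \<subseteq> K"
    using compactin_subset_topspace[OF CU(1)] by simp
  have "\<exists>V. openin T' V \<and> y \<in> V \<and> V \<subseteq> \<Phi> -` N \<inter> topspace T'" if "y \<in> \<Phi> -` N \<inter> topspace T'" for y
  proof -
    have y: "y \<in> carrier G'" "\<Phi> y ` C \<subseteq> U"
      using that N by auto
    have "compactin X (\<Phi> y ` C)"
      using image_compactin[OF CU(1) H_plusD(3)] y(1) by simp
    from compact_Hausdorff_shrink[OF compact_X Hausdorff_X this CU(2) y(2)]
    obtain W where W: "openin X W" "\<Phi> y ` C \<subseteq> W" "X closure_of W \<subseteq> U"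
      by blast
    have "\<forall>\<^sub>F g in trace_filter y. \<phi> g \<in> {f \<in> carrier H. f ` C \<subseteq> W}"
      using \<Phi>_neighbourhood[OF y(1) openin_HT[OF CU(1) W(1)]] y(1) W(2) by simp
    then obtain V where V: "openin T' V" "y \<in> V" "\<forall>g\<in>carrier G. \<iota> g \<in> V \<longrightarrow> \<phi> g ` C \<subseteq> W"
      unfolding eventually_trace[OF y(1)] by blast
    have "\<Phi> z c \<in> U" if z: "z \<in> V" and c: "c \<in> C" for z c
    proof -
      have z': "z \<in> carrier G'"
        using z openin_subset[OF V(1)] by auto
      \<comment> \<open>The open set \<open>V\<close> is a neighbourhood of each of its points
        \<open>z\<close>, so the estimate found at \<open>y\<close> also holds along the trace
        filter of \<open>z\<close>.\<close>
      have "\<forall>\<^sub>F g in trace_filter z. \<phi> g ` C \<subseteq> W"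
        unfolding eventually_trace[OF z'] using V z by blast
      then have "\<forall>\<^sub>F g in trace_filter z. \<phi> g c \<in> X closure_of W"
        by eventually_elim (use c closure_of_subset[OF openin_subset[OF W(1)]] in blast)
      then have "\<Phi> z c \<in> X closure_of W"
        using limitin_HT_pointwise[OF \<Phi>_limit[OF z'], of c] c C trace_neq_bot[OF z']
        by (intro limitin_closedin) auto
      then show ?thesis
        using W(3) by blast
    qed
    then have "V \<subseteq> \<Phi> -` N \<inter> topspace T'"
      using openin_subset[OF V(1)] by (auto simp: N)
    with V(1,2) show ?thesis by blast
  qed
  then show ?case
    by (subst openin_subopen) blast
next
  case 2
  have "\<Phi> ` topspace T' \<subseteq> topspace HT" by auto
  then show ?case
    unfolding H_plus_topology_def compact_open_topology_def topology_generated_by_topspace .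
qed

section \<open>Openness and injectivity of \<open>\<Phi>\<close>\<close>

text \<open>The embedding \<open>\<phi>\<close> only controls elements of \<open>G\<close>, so
  \<open>y\<close> is approximated: if \<open>\<Phi> y\<close> lies in \<open>N\<close>, so does
  \<open>\<phi> g\<close> for \<open>g\<close> near \<open>y\<close>, which forces
  \<open>g \<in> V\<close>. Then \<open>y\<close> is the product of \<open>\<iota> g\<close>, in
  \<open>U1\<close>, and the quotient of \<open>y\<close> by \<open>\<iota> g\<close>, in
  \<open>U2\<close>.\<close>

lemma \<Phi>_open_one:
  assumes U: "openin T' U" "\<one>\<^bsub>G'\<^esub> \<in> U"
  obtains N where "openin HT N" "(\<lambda>x\<in>K. x) \<in> N" "\<And>y. y \<in> carrier G' \<Longrightarrow> \<Phi> y \<in> N \<Longrightarrow> y \<in> U"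
proof -
  obtain U1 U2 where U12: "openin T' U1" "openin T' U2" "\<one>\<^bsub>G'\<^esub> \<in> U1" "\<one>\<^bsub>G'\<^esub> \<in> U2"
    "\<And>u v. u \<in> U1 \<Longrightarrow> v \<in> U2 \<Longrightarrow> u \<otimes>\<^bsub>G'\<^esub> v \<in> U"
    by (rule continuous_map_prod_neighbourhood[OF topological_groupD(3)[OF G'], of "\<one>\<^bsub>G'\<^esub>" "\<one>\<^bsub>G'\<^esub>" U])
      (use U in auto)
  obtain V where V: "openin T V" "\<one>\<^bsub>G\<^esub> \<in> V" "\<And>g. g \<in> V \<Longrightarrow> \<iota> g \<in> U1"
    using \<iota>_continuous_one[OF U12(1,3)] by blast
  have "homeomorphic_map T (subtopology HT (\<phi> ` carrier G)) \<phi>"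
    using \<phi>(2) by (simp add: embedding_map_def)
  then have "openin (subtopology HT (\<phi> ` carrier G)) (\<phi> ` V)"
    using V(1) homeomorphic_imp_open_map open_map_def by blast
  then obtain N where N: "openin HT N" "\<phi> ` V = N \<inter> \<phi> ` carrier G"
    unfolding openin_subtopology by blast
  show thesis
  proof
    show "(\<lambda>x\<in>K. x) \<in> N"
      using N(2) V(2) \<phi>_one by (metis IntE imageI)
    fix y assume y: "y \<in> carrier G'" "\<Phi> y \<in> N"
    have 1: "\<forall>\<^sub>F g in trace_filter y. \<phi> g \<in> N"
      using \<Phi>_neighbourhood[OF y(1) N(1) y(2)] .
    obtain W1 W2 where W: "openin T' W1" "openin T' W2" "y \<in> W1" "y \<in> W2"
      "\<And>u v. u \<in> W1 \<Longrightarrow> v \<in> W2 \<Longrightarrow> inv\<^bsub>G'\<^esub> u \<otimes>\<^bsub>G'\<^esub> v \<in> U2"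
      by (rule continuous_map_prod_neighbourhood[OF topological_groupD(6)[OF G'], of y y U2])
        (use y U12 in auto)
    have "\<forall>\<^sub>F g in trace_filter y. \<iota> g \<in> W1"
      using W eventually_trace[OF y(1)] by blast
    with 1 eventually_trace_carrier[of y]
    \<comment> \<open>The conclusion does not mention \<open>g\<close>: one suitable
      \<open>g\<close> is enough, and the filter, being proper, supplies it.\<close>
    have "\<forall>\<^sub>F g in trace_filter y. y \<in> U"
    proof eventually_elim
      case (elim g)
      then obtain v where "v \<in> V" "\<phi> g = \<phi> v"
        using N(2) by blast
      moreover have "v \<in> carrier G"
        using \<open>v \<in> V\<close> openin_subset[OF V(1)] by auto
      ultimately have "g \<in> V"
        using \<phi>(1) elim(2) unfolding mon_def inj_on_def by blast
      then have "\<iota> g \<otimes>\<^bsub>G'\<^esub> (inv\<^bsub>G'\<^esub> \<iota> g \<otimes>\<^bsub>G'\<^esub> y) \<in> U"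
        using V(3) W(4,5) U12(5) elim(3) by blast
      then show "y \<in> U"
        using y(1) elim(2) by (simp add: G'.m_assoc[symmetric])
    qed
    then show "y \<in> U"
      using trace_neq_bot[OF y(1)] by (simp add: eventually_const)
  qed (rule N(1))
qed

text \<open>A point sent to the identity lies in every neighbourhood of the unit by
  \<open>\<Phi>_open_one\<close>, so it is the unit because \<open>T'\<close> is Hausdorff.\<close>

lemma \<Phi>_inj: "inj_on \<Phi> (carrier G')"
proof (rule inj_onI)
  fix x y assume xy: "x \<in> carrier G'" "y \<in> carrier G'" "\<Phi> x = \<Phi> y"
  let ?z = "inv\<^bsub>G'\<^esub> x \<otimes>\<^bsub>G'\<^esub> y"
  have "\<Phi> ?z = compose K (\<Phi> (inv\<^bsub>G'\<^esub> x)) (\<Phi> x)"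
    using xy by (simp add: \<Phi>_mult)
  also have "\<dots> = \<Phi> (inv\<^bsub>G'\<^esub> x \<otimes>\<^bsub>G'\<^esub> x)"
    using xy(1) by (subst \<Phi>_mult) auto
  finally have z: "\<Phi> ?z = (\<lambda>x\<in>K. x)"
    using xy(1) by (simp add: \<Phi>_one)
  have "?z \<in> U" if "openin T' U" "\<one>\<^bsub>G'\<^esub> \<in> U" for U
    by (rule \<Phi>_open_one[OF that]) (use z xy in auto)
  moreover have "?z \<in> topspace T'" "\<one>\<^bsub>G'\<^esub> \<in> topspace T'"
    using xy by auto
  ultimately have "?z = \<one>\<^bsub>G'\<^esub>"
    using Hausdorff unfolding Hausdorff_space_def disjnt_iff by metis
  then show "x = y"
    using xy by (metis G'.inv_equality G'.inv_inv G'.inv_closed)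
qed

text \<open>Openness at the unit is transported to \<open>y\<close>: the neighbourhood
  \<open>M\<close> of \<open>\<Phi> y\<close> is the preimage of \<open>N\<close> under left
  translation by \<open>\<Phi>\<close> of the inverse of \<open>y\<close>.\<close>

lemma \<Phi>_open_map: "open_map T' (subtopology HT (\<Phi> ` carrier G')) \<Phi>"
  unfolding open_map_def
proof (intro allI impI)
  fix U assume U: "openin T' U"
  have "\<exists>N. openin (subtopology HT (\<Phi> ` carrier G')) N \<and> \<Phi> y \<in> N \<and> N \<subseteq> \<Phi> ` U"
    if yU: "y \<in> U" for y
  proof -
    have y: "y \<in> carrier G'"
      using yU openin_subset[OF U] by auto
    obtain V W where VW: "openin T' V" "openin T' W" "y \<in> V" "\<one>\<^bsub>G'\<^esub> \<in> W"
      "\<And>u v. u \<in> V \<Longrightarrow> v \<in> W \<Longrightarrow> u \<otimes>\<^bsub>G'\<^esub> v \<in> U"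
      by (rule continuous_map_prod_neighbourhood[OF topological_groupD(3)[OF G'], of y "\<one>\<^bsub>G'\<^esub>" U])
        (use U y yU in auto)
    obtain N where N: "openin HT N" "(\<lambda>x\<in>K. x) \<in> N" "\<And>z. z \<in> carrier G' \<Longrightarrow> \<Phi> z \<in> N \<Longrightarrow> z \<in> W"
      by (rule \<Phi>_open_one[OF VW(2,4)]) blast
    define M where "M = {f \<in> topspace HT. compose K (\<Phi> (inv\<^bsub>G'\<^esub> y)) f \<in> N}"
    have "openin HT M"
      unfolding M_def
      by (rule openin_continuous_map_preimage[OF continuous_map_HT_compose N(1)]) (use y in simp)
    moreover have "\<Phi> y \<in> M"
      using y N(2) \<Phi>_mult[of "inv\<^bsub>G'\<^esub> y" y] by (simp add: M_def \<Phi>_one)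
    moreover have "z \<in> U" if z: "z \<in> carrier G'" "\<Phi> z \<in> M" for z
    proof -
      have "inv\<^bsub>G'\<^esub> y \<otimes>\<^bsub>G'\<^esub> z \<in> W"
        using z y by (intro N(3)) (auto simp: M_def \<Phi>_mult)
      then have "y \<otimes>\<^bsub>G'\<^esub> (inv\<^bsub>G'\<^esub> y \<otimes>\<^bsub>G'\<^esub> z) \<in> U"
        using VW(3,5) by blast
      then show ?thesis
        using y z(1) by (simp add: G'.m_assoc[symmetric])
    qed
    ultimately show ?thesis
      using y by (intro exI[of _ "M \<inter> \<Phi> ` carrier G'"]) (auto simp: openin_subtopology)
  qed
  then show "openin (subtopology HT (\<Phi> ` carrier G')) (\<Phi> ` U)"
    by (subst openin_subopen) blast
qed

lemma \<Phi>_mon: "\<Phi> \<in> mon G' H"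
  unfolding mon_def hom_def using \<Phi>_inj by (auto simp: \<Phi>_mult mult_H)

lemma \<Phi>_embedding: "embedding_map T' HT \<Phi>"
  unfolding embedding_map_def
proof (rule bijective_open_imp_homeomorphic_map)
  show "continuous_map T' (subtopology HT (\<Phi> ` topspace T')) \<Phi>"
    using \<Phi>_continuous by (simp add: continuous_map_in_subtopology)
  show "\<Phi> ` topspace T' = topspace (subtopology HT (\<Phi> ` topspace T'))"
    by auto
qed (use \<Phi>_open_map \<Phi>_inj in auto)

end

theorem proposition4p1:
  fixes G :: "('a, 'm) monoid_scheme" and \<tau> :: "'a topology"
    and G' :: "('b, 'n) monoid_scheme" and \<tau>' :: "'b topology"
    and \<iota> :: "'a \<Rightarrow> 'b"
  assumes "orderly TYPE('k) G \<tau>"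
    and "is_raikov_completion G \<tau> G' \<tau>' \<iota>"
  shows "orderly TYPE('k) G' \<tau>'"
proof -
  obtain K :: "'k set" and r \<phi> where "topological_group G \<tau>" "compact_linearly_ordered_space K r"
    "\<phi> \<in> mon G (H_plus K r)" "embedding_map \<tau> (H_plus_topology K r) \<phi>"
    using assms(1) unfolding orderly_def by blast
  then interpret orderly_completion K r G \<tau> G' \<tau>' \<iota> \<phi>
    using assms(2) by unfold_locales
  show ?thesis
    unfolding orderly_def using G' clos \<Phi>_mon \<Phi>_embedding by blast
qed

end
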